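(* Let $x_0\in X$ and $R_0>0$, and assume that $\mu(\{x_0\})=0$. If for some $\eta>0$ there is a constant $C$ such that $$\mu(B(x_0,R)\setminus B(x_0,r))\le C\Bigl(1-\frac rR\Bigr)^{\eta}\mu(B(x_0,R))\qquad\text{for all } 0<r<R<R_0,$$ then $\eta\le1$.
   Context: $X=(X,d,\mu)$ is a metric space equipped with a metric $d$ and a positive complete Borel measure $\mu$ such that $0<\mu(B)<\infty$ for all balls $B\subset X$. $B(x,r)=\{y\in X: d(y,x)<r\}$. *)

theory Defs
  imports "HOL-Analysis.Analysis"
begin

text \<open>
  The space $X$ is the whole of a type of class \<open>metric_space\<close>. A complete Borel measure is a
  complete measure for which every Borel set is measurable; completeness forces its
  sigma-algebra to be in general larger than \<^term>\<open>sets borel\<close>, hence the inclusion below.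
\<close>

locale metric_measure_space = complete_measure M
  for M :: "'a::metric_space measure" +
  assumes space_UNIV: "space M = UNIV"
    and borel_sets: "sets borel \<subseteq> sets M"
    and ball_pos: "\<And>x r. 0 < r \<Longrightarrow> 0 < emeasure M (ball x r)"
    and ball_finite: "\<And>x r. 0 < r \<Longrightarrow> emeasure M (ball x r) < \<infinity>"

end

theory Submission
  imports Defs
begin

text \<open>
  If \<open>\<eta> > 1\<close>, then on every \<open>[s, R]\<close> with \<open>0 < s < R < R0\<close> the function
  \<open>r \<mapsto> \<mu>(B(x0, r))\<close> satisfies a Hoelder condition of exponent greater than \<open>1\<close>, hence it is
  constant. So the annuli around \<open>x0\<close> are null, and together with the null set \<open>{x0}\<close>
  countably many of them cover a ball, which has positive measure.
\<close>

text \<open>Cut \<open>[a, b]\<close> into \<open>n\<close> equal pieces. Each increment is at most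
  \<open>K * ((b - a) / n) powr \<eta>\<close>, so the total is at most a constant times
  \<open>n powr (1 - \<eta>)\<close>, which tends to 0 because \<open>\<eta> > 1\<close>.\<close>

lemma superlinear_increment_imp_le:
  fixes f :: "real \<Rightarrow> real"
  assumes "a < b" and "1 < \<eta>"
    and incr: "\<And>x y. a \<le> x \<Longrightarrow> x < y \<Longrightarrow> y \<le> b \<Longrightarrow> f y - f x \<le> K * (y - x) powr \<eta>"
  shows "f b \<le> f a"
proof -
  have bound: "f b - f a \<le> K * (b - a) powr \<eta> * real n powr (1 - \<eta>)" if "0 < n" for n
  proof -
    define h where "h = (b - a) / real n"
    define t where "t = (\<lambda>i. a + real i * h)"
    have h: "0 < h" and tn: "t n = b"
      using \<open>a < b\<close> \<open>0 < n\<close> by (simp_all add: h_def t_def)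
    have "f b - f a = (\<Sum>i<n. f (t (Suc i)) - f (t i))"
      by (subst sum_lessThan_telescope[of "\<lambda>i. f (t i)"]) (simp add: tn, simp add: t_def)
    also have "\<dots> \<le> (\<Sum>i<n. K * h powr \<eta>)"
    proof (rule sum_mono)
      fix i assume "i \<in> {..<n}"
      then have "real (Suc i) * h \<le> real n * h"
        using h by (intro mult_right_mono) auto
      then have "t (Suc i) \<le> b"
        using tn by (simp add: t_def)
      moreover have "a \<le> t i" and step: "t (Suc i) - t i = h"
        using h by (simp_all add: t_def algebra_simps)
      ultimately show "f (t (Suc i)) - f (t i) \<le> K * h powr \<eta>"
        using incr[of "t i" "t (Suc i)"] h by simp
    qed
    also have "\<dots> = K * (b - a) powr \<eta> * real n powr (1 - \<eta>)"
      using \<open>a < b\<close> \<open>0 < n\<close> by (simp add: h_def powr_divide powr_diff)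
    finally show ?thesis .
  qed
  have "(\<lambda>n. K * (b - a) powr \<eta> * real n powr (1 - \<eta>)) \<longlonglongrightarrow> K * (b - a) powr \<eta> * 0"
    using \<open>1 < \<eta>\<close>
    by (intro tendsto_mult_left tendsto_neg_powr filterlim_real_sequentially) simp
  then have "f b - f a \<le> K * (b - a) powr \<eta> * 0"
    by (rule LIMSEQ_le_const) (use bound in \<open>auto intro!: exI[of _ 1]\<close>)
  then show ?thesis by simp
qed

theorem proposition3p4:
  fixes M :: "'a::metric_space measure" and x0 :: 'a and R0 \<eta> :: real
  assumes "metric_measure_space M"
    and "0 < R0"
    and "emeasure M {x0} = 0"
    and "0 < \<eta>"
    and "\<exists>C::real. \<forall>r R. 0 < r \<and> r < R \<and> R < R0 \<longrightarrow>
           measure M (ball x0 R - ball x0 r) \<le> C * (1 - r / R) powr \<eta> * measure M (ball x0 R)"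
  shows "\<eta> \<le> 1"
proof (rule ccontr)
  assume "\<not> \<eta> \<le> 1"
  then have \<eta>: "1 < \<eta>" by simp
  interpret metric_measure_space M by fact
  obtain C where C: "\<And>r R. 0 < r \<Longrightarrow> r < R \<Longrightarrow> R < R0 \<Longrightarrow>
      measure M (ball x0 R - ball x0 r) \<le> C * (1 - r / R) powr \<eta> * measure M (ball x0 R)"
    using assms(5) by blast
  have sets [measurable]: "ball x0 r \<in> sets M" "{x0} \<in> sets M" for r
    using borel_sets by auto
  have fin: "ball x0 r \<in> fmeasurable M" for r
    using sets ball_finite[of r x0]
    \<comment> \<open>\<open>ball_finite\<close> covers positive radii only; for the others the ball
      is empty.\<close>
    by (cases "0 < r") (auto intro!: fmeasurableI simp: ball_empty)
  define f where "f = (\<lambda>r. measure M (ball x0 r))"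
  have diff: "measure M (ball x0 y - ball x0 x) = f y - f x" if "x < y" for x y
    unfolding f_def using fin that by (intro measurable_measure_Diff) auto
  \<comment> \<open>The growth condition holds for outer radii strictly below \<open>R0\<close>, so
    the closed interval \<open>[s, R]\<close> has to end before \<open>R0\<close>.\<close>
  define R where "R = R0 / 2"
  have R: "0 < R" "R < R0" using \<open>0 < R0\<close> by (simp_all add: R_def)
  have null: "ball x0 R - ball x0 s \<in> null_sets M" if s: "0 < s" "s < R" for s
  proof -
    have "f R \<le> f s"
    proof (rule superlinear_increment_imp_le[OF \<open>s < R\<close> \<eta>])
      fix x y assume xy: "s \<le> x" "x < y" "y \<le> R"
      have "1 - x / y = (y - x) / y" using s xy by (simp add: field_simps)
      \<comment> \<open>The Hoelder constant must not depend on \<open>x\<close> and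
        \<open>y\<close>: the denominator \<open>y\<close> is bounded below by \<open>s\<close>, and
        the factor \<open>f y\<close> above by \<open>f R\<close>. Taking
        \<open>\<bar>C\<bar>\<close> keeps the product monotone, since \<open>C\<close> may be
        negative.\<close>
      also have "\<dots> \<le> (y - x) / s" using s xy by (intro divide_left_mono) auto
      finally have ratio: "(1 - x / y) powr \<eta> \<le> ((y - x) / s) powr \<eta>"
        using \<eta> s xy by (intro powr_mono2) auto
      have fy: "f y \<le> f R"
        unfolding f_def using fin xy by (intro measure_mono_fmeasurable) auto
      have "f y - f x \<le> C * (1 - x / y) powr \<eta> * f y"
        using C[of x y] diff[of x y] s xy R by (simp add: f_def)
      also have "\<dots> \<le> \<bar>C\<bar> * ((y - x) / s) powr \<eta> * f R"
        using ratio fy by (intro mult_mono) (auto simp: f_def)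
      also have "\<dots> = \<bar>C\<bar> * f R / s powr \<eta> * (y - x) powr \<eta>"
        using s xy by (simp add: powr_divide)
      finally show "f y - f x \<le> \<bar>C\<bar> * f R / s powr \<eta> * (y - x) powr \<eta>" .
    qed
    then have "measure M (ball x0 R - ball x0 s) = 0"
      using diff[OF s(2)] measure_nonneg[of M "ball x0 R - ball x0 s"] by linarith
    \<comment> \<open>\<open>measure\<close> is also 0 on sets of infinite measure, so finiteness is
      what turns the value 0 into a null set.\<close>
    moreover have "ball x0 R - ball x0 s \<in> fmeasurable M"
      using fin by (intro fmeasurable_Diff) auto
    ultimately show ?thesis
      by (simp add: null_sets_def fmeasurable_def emeasure_eq_ennreal_measure)
  qed
  \<comment> \<open>The inner radii shrink to 0, so only the centre escapes all annuli. The shift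
    \<open>n + 2\<close> keeps them strictly below \<open>R\<close> already at \<open>n = 0\<close>,
    as \<open>null\<close> demands.\<close>
  have "ball x0 R \<subseteq> {x0} \<union> (\<Union>n. ball x0 R - ball x0 (R / real (n + 2)))"
  proof
    fix z assume z: "z \<in> ball x0 R"
    show "z \<in> {x0} \<union> (\<Union>n. ball x0 R - ball x0 (R / real (n + 2)))"
    proof (cases "z = x0")
      case False
      then have d: "0 < dist x0 z" by simp
      obtain n where "R / dist x0 z < real n" using reals_Archimedean2 by blast
      with d have "R < real n * dist x0 z" by (simp add: field_simps)
      also have "\<dots> \<le> real (n + 2) * dist x0 z" using d by (intro mult_right_mono) auto
      finally have "R / real (n + 2) \<le> dist x0 z"
        by (simp add: field_simps)
      with z have "z \<in> ball x0 R - ball x0 (R / real (n + 2))" by simp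
      then show ?thesis by blast
    qed simp
  qed
  moreover have "{x0} \<union> (\<Union>n. ball x0 R - ball x0 (R / real (n + 2))) \<in> null_sets M"
    using assms(3) R
    by (intro null_sets.Un null_sets_UN null null_setsI sets)
      (auto simp: field_simps add_pos_nonneg)
  ultimately have "ball x0 R \<in> null_sets M"
    using sets null_sets_subset by blast
  then show False using ball_pos[OF R(1), of x0] by auto
qed

end
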